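(* For every integer $n \geq 1$, the number of perfect multi Skolem-type sequences of order $n$ is $(2n-1)!! = (2n-1)(2n-3)\cdots 3\cdot 1$.
   Context: A perfect multi Skolem-type sequence of order $n$ is a sequence $(x_1,\dots,x_{2n})$ of positive integers for which the set of positions $\{1,\dots,2n\}$ can be partitioned into $n$ two-element subsets $\{i,j\}$ such that $x_i = x_j = |i-j|$ for each of these subsets. (The multiset of the $n$ differences, one for each pair, is the multiset from which the sequence is generated; it has cardinality $n$ and elements may be repeated.) *)

theory Defs
  imports Main "HOL-Library.FuncSet" "HOL-Library.Disjoint_Sets"
begin

(* A sequence (x_1, ..., x_{2n}) of positive integers is a function on the positions {1..2n};
   the extensional function space makes each sequence a single function, so that they can be
   counted.  Differences of positions are taken in int because subtraction on nat truncates. *)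
definition perfect_multi_skolem :: "nat \<Rightarrow> (nat \<Rightarrow> nat) \<Rightarrow> bool" where
  "perfect_multi_skolem n x \<longleftrightarrow>
     x \<in> {1..2 * n} \<rightarrow>\<^sub>E {1..} \<and>
     (\<exists>P. partition_on {1..2 * n} P \<and> card P = n \<and>
        (\<forall>p\<in>P. \<exists>i j. i \<noteq> j \<and> p = {i, j} \<and>
           x i = x j \<and> int (x j) = \<bar>int i - int j\<bar>))"

(* The double factorial (2n-1)!! = (2n-1)(2n-3)...3.1 is written with i = 1, ..., n, so the
   natural-number subtraction 2i - 1 is exact. *)
definition odd_double_fact :: "nat \<Rightarrow> nat" where
  "odd_double_fact n = (\<Prod>i = 1..n. 2 * i - 1)"

end

theory Submission
  imports Defs
begin

text \<open>
  A perfect matching of the positions \<open>{1..2n}\<close> yields a sequence by writing, at each position, the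
  distance to its partner, and every perfect multi Skolem-type sequence arises in this way. The
  matching can be recovered from the sequence: the partner of the least position \<open>a\<close> can only lie to
  its right, so it is \<open>a + x a\<close>; once this pair is removed the same reasoning applies to the least
  position that is left, and so on. Thus the sequences are as many as the perfect matchings.

  Removing one pair leaves a set of positions that is no longer an interval, so the count is carried
  out for an arbitrary finite set \<open>A\<close> of positions. There are \<open>card A - 1\<close> choices for the partner
  of \<open>Min A\<close>, and each leaves the same problem on \<open>A\<close> without two points
  (\<open>skolem_seqs_eq_image\<close>, \<open>inj_on_add_pair\<close>), which is the recursion of the double factorial.
\<close>

definition skolem_block :: "(nat \<Rightarrow> nat) \<Rightarrow> nat set \<Rightarrow> bool" where
  "skolem_block x p \<longleftrightarrow>
     (\<exists>i j. i \<noteq> j \<and> p = {i, j} \<and> x i = x j \<and> int (x j) = \<bar>int i - int j\<bar>)"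

definition skolem_seqs :: "nat set \<Rightarrow> (nat \<Rightarrow> nat) set" where
  "skolem_seqs A =
     {x \<in> A \<rightarrow>\<^sub>E {1..}. \<exists>P. partition_on A P \<and> (\<forall>p\<in>P. skolem_block x p)}"

definition add_pair :: "nat \<Rightarrow> nat \<Rightarrow> (nat \<Rightarrow> nat) \<Rightarrow> nat \<Rightarrow> nat" where
  "add_pair a b y = y(a := b - a, b := b - a)"

lemma skolem_block_cong:
  assumes "\<And>i. i \<in> p \<Longrightarrow> x i = y i"
  shows "skolem_block x p \<longleftrightarrow> skolem_block y p"
proof -
  have "skolem_block y p" if "skolem_block x p" "\<And>i. i \<in> p \<Longrightarrow> x i = y i" for x y
    using that unfolding skolem_block_def by (metis insertCI)
  then show ?thesis using assms by metis
qed

lemma skolem_blockE_min: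
  assumes "skolem_block x p" "a \<in> p" "\<And>i. i \<in> p \<Longrightarrow> a \<le> i"
  obtains b where "a < b" "p = {a, b}" "x a = b - a" "x b = b - a"
proof -
  obtain i j where ij: "i \<noteq> j" "p = {i, j}" "x i = x j" "int (x j) = \<bar>int i - int j\<bar>"
    using assms(1) unfolding skolem_block_def by blast
  have le: "a \<le> i" "a \<le> j" using assms(3) ij(2) by simp_all
  have "a = i \<or> a = j" using assms(2) ij(2) by simp
  then show ?thesis
  proof
    assume "a = i"
    then have "a < j" "x j = j - a" using ij(1,4) le by linarith+
    then show ?thesis using that[of j] ij(2,3) \<open>a = i\<close> by simp
  next
    assume "a = j"
    then have "a < i" "x j = i - a" using ij(1,4) le by linarith+
    then show ?thesis using that[of i] ij(2,3) \<open>a = j\<close> by (simp add: insert_commute)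
  qed
qed

lemma skolem_block_add_pair: "a < b \<Longrightarrow> skolem_block (add_pair a b y) {a, b}"
  unfolding skolem_block_def add_pair_def
  by (intro exI[of _ a] exI[of _ b]) auto

lemma add_pair_in_skolem_seqs:
  assumes "a \<in> A" "b \<in> A" "a < b" "y \<in> skolem_seqs (A - {a, b})"
  shows "add_pair a b y \<in> skolem_seqs A"
proof -
  obtain P where P: "partition_on (A - {a, b}) P" "\<And>p. p \<in> P \<Longrightarrow> skolem_block y p"
    and y: "y \<in> (A - {a, b}) \<rightarrow>\<^sub>E {1..}"
    using assms(4) unfolding skolem_seqs_def by auto
  have "disjnt {a, b} (\<Union>P)"
    unfolding partition_onD1[OF P(1), symmetric] disjnt_def by blast
  then have "partition_on A (insert {a, b} P)"
    using partition_on_insert[of "{a, b}" P A] P(1) assms(1,2) by simp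
  moreover have "skolem_block (add_pair a b y) p" if "p \<in> insert {a, b} P" for p
  proof (cases "p = {a, b}")
    case False
    then have "p \<in> P" using that by blast
    then have "p \<subseteq> A - {a, b}" using P(1) unfolding partition_on_def by blast
    then have "skolem_block (add_pair a b y) p \<longleftrightarrow> skolem_block y p"
      by (intro skolem_block_cong) (auto simp: add_pair_def)
    then show ?thesis using P(2)[OF \<open>p \<in> P\<close>] by simp
  qed (use assms skolem_block_add_pair in simp)
  moreover have "add_pair a b y \<in> A \<rightarrow>\<^sub>E {1..}"
    using y assms unfolding add_pair_def PiE_iff extensional_def by auto
  ultimately show ?thesis unfolding skolem_seqs_def by blast
qed

text \<open>
  This is the greedy step: the block of the least position determines that position's partner, and
  the other blocks witness that the remaining values solve the problem on the remaining positions.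
\<close>

lemma skolem_seqs_remove_min:
  assumes "x \<in> skolem_seqs A" "a \<in> A" "\<And>i. i \<in> A \<Longrightarrow> a \<le> i"
  obtains b y where "b \<in> A - {a}" "y \<in> skolem_seqs (A - {a, b})" "x = add_pair a b y"
proof -
  obtain P where P: "partition_on A P" "\<And>p. p \<in> P \<Longrightarrow> skolem_block x p"
    and x: "x \<in> A \<rightarrow>\<^sub>E {1..}"
    using assms(1) unfolding skolem_seqs_def by auto
  obtain p where p: "p \<in> P" "a \<in> p"
    using P(1) assms(2) unfolding partition_on_def by blast
  have "p \<subseteq> A" using P(1) p(1) unfolding partition_on_def by blast
  then obtain b where b: "a < b" "p = {a, b}" "x a = b - a" "x b = b - a"
    using skolem_blockE_min[OF P(2)[OF p(1)] p(2)] assms(3) by blast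
  define y where "y = restrict x (A - {a, b})"
  have part: "partition_on (A - {a, b}) (P - {p})"
  proof -
    have "disjnt p (\<Union>(P - {p}))"
      using partition_onD2[OF P(1)] p(1) unfolding disjnt_def disjoint_def by blast
    then show ?thesis
      using partition_on_insert[of p "P - {p}" A] P(1) p(1) b(2) by (simp add: insert_absorb)
  qed
  have "skolem_block y q" if "q \<in> P - {p}" for q
  proof -
    have "q \<subseteq> A - {a, b}" using part that unfolding partition_on_def by blast
    then have "skolem_block y q \<longleftrightarrow> skolem_block x q"
      by (intro skolem_block_cong) (auto simp: y_def)
    then show ?thesis using P(2) that by simp
  qed
  moreover have "y \<in> (A - {a, b}) \<rightarrow>\<^sub>E {1..}"
    using x unfolding y_def by auto
  ultimately have "y \<in> skolem_seqs (A - {a, b})"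
    using part unfolding skolem_seqs_def by blast
  moreover have "x = add_pair a b y"
    using x b \<open>p \<subseteq> A\<close> by (auto simp: fun_eq_iff add_pair_def y_def PiE_iff extensional_def)
  ultimately show ?thesis using that b \<open>p \<subseteq> A\<close> by blast
qed

lemma skolem_seqs_eq_image:
  assumes "a \<in> A" "\<And>i. i \<in> A \<Longrightarrow> a \<le> i"
  shows "skolem_seqs A =
    (\<lambda>(b, y). add_pair a b y) ` (SIGMA b : A - {a}. skolem_seqs (A - {a, b}))"
proof (intro equalityI subsetI)
  fix x assume "x \<in> skolem_seqs A"
  then obtain b y where "b \<in> A - {a}" "y \<in> skolem_seqs (A - {a, b})" "x = add_pair a b y"
    using skolem_seqs_remove_min assms by blast
  then show "x \<in> (\<lambda>(b, y). add_pair a b y) ` (SIGMA b : A - {a}. skolem_seqs (A - {a, b}))"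
    by (intro image_eqI[of _ _ "(b, y)"]) auto
next
  fix x assume "x \<in> (\<lambda>(b, y). add_pair a b y) ` (SIGMA b : A - {a}. skolem_seqs (A - {a, b}))"
  then obtain b y where "b \<in> A - {a}" "y \<in> skolem_seqs (A - {a, b})" "x = add_pair a b y"
    by auto
  moreover from this have "a < b" using assms(2)[of b] by auto
  ultimately show "x \<in> skolem_seqs A"
    using add_pair_in_skolem_seqs[of a A b y] assms(1) by blast
qed

text \<open>
  The partner \<open>b\<close> is recovered as \<open>a\<close> plus the value at \<open>a\<close>; this is where it matters that \<open>a\<close> is
  least, since a partner \<open>a - x a\<close> on the left would be a second candidate.
\<close>

lemma inj_on_add_pair:
  assumes "\<And>i. i \<in> A \<Longrightarrow> a \<le> i"
  shows "inj_on (\<lambda>(b, y). add_pair a b y) (SIGMA b : A - {a}. skolem_seqs (A - {a, b}))"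
proof (rule inj_onI)
  fix v w
  assume "v \<in> (SIGMA b : A - {a}. skolem_seqs (A - {a, b}))"
    and "w \<in> (SIGMA b : A - {a}. skolem_seqs (A - {a, b}))"
    and "(\<lambda>(b, y). add_pair a b y) v = (\<lambda>(b, y). add_pair a b y) w"
  then obtain b y c z where vw: "v = (b, y)" "w = (c, z)"
    and b: "b \<in> A" "y \<in> skolem_seqs (A - {a, b})"
    and c: "c \<in> A" "z \<in> skolem_seqs (A - {a, c})"
    and eq: "add_pair a b y = add_pair a c z"
    by (elim SigmaE) simp
  have "b - a = c - a" using fun_cong[OF eq, of a] by (auto simp: add_pair_def split: if_splits)
  then have "b = c" using assms[OF b(1)] assms[OF c(1)] by linarith
  moreover have "y i = z i" for i
  proof (cases "i \<in> {a, b}")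
    case True
    then show ?thesis
      using b(2) c(2) \<open>b = c\<close> unfolding skolem_seqs_def PiE_iff extensional_def by auto
  next
    case False
    then show ?thesis using fun_cong[OF eq, of i] \<open>b = c\<close> by (simp add: add_pair_def)
  qed
  ultimately show "v = w" using vw by blast
qed

lemma odd_double_fact_pos: "odd_double_fact n > 0"
  unfolding odd_double_fact_def by (intro prod_pos) auto

lemma card_skolem_seqs:
  assumes "finite A" "card A = 2 * n"
  shows "card (skolem_seqs A) = odd_double_fact n"
  using assms
proof (induction n arbitrary: A)
  case 0
  then have "skolem_seqs A = {\<lambda>_. undefined}"
    by (auto simp: skolem_seqs_def partition_on_empty)
  then show ?case by (simp add: odd_double_fact_def)
next
  case (Suc n)
  define a where "a = Min A"
  have "A \<noteq> {}" using Suc.prems by auto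
  then have a: "a \<in> A" "\<And>i. i \<in> A \<Longrightarrow> a \<le> i"
    unfolding a_def using Suc.prems(1) by auto
  have IH: "card (skolem_seqs (A - {a, b})) = odd_double_fact n" if "b \<in> A - {a}" for b
    using Suc.IH[of "A - {a, b}"] Suc.prems a(1) that by (simp add: card_Diff_subset)
  \<comment> \<open>An infinite set has cardinality 0, which the double factorial is not.\<close>
  have fin: "finite (skolem_seqs (A - {a, b}))" if "b \<in> A - {a}" for b
    using IH[OF that] odd_double_fact_pos[of n] by (metis card.infinite less_irrefl)
  have "card (skolem_seqs A) = card (SIGMA b : A - {a}. skolem_seqs (A - {a, b}))"
    using card_image[OF inj_on_add_pair[of A a]] skolem_seqs_eq_image[of a A] a by simp
  also have "\<dots> = (\<Sum>b\<in>A - {a}. card (skolem_seqs (A - {a, b})))"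
    using Suc.prems(1) fin by (intro card_SigmaI) auto
  also have "\<dots> = (2 * n + 1) * odd_double_fact n"
    using IH Suc.prems a(1) by simp
  also have "\<dots> = odd_double_fact (Suc n)"
    by (simp add: odd_double_fact_def)
  finally show ?case .
qed

text \<open>
  Each block has two elements, so counting the \<open>2 * n\<close> positions block by block shows that every
  partition into such blocks has exactly \<open>n\<close> of them.
\<close>

lemma perfect_multi_skolem_iff: "perfect_multi_skolem n x \<longleftrightarrow> x \<in> skolem_seqs {1..2 * n}"
proof -
  have "card P = n" if P: "partition_on {1..2 * n} P" and blocks: "\<forall>p\<in>P. skolem_block x p" for P
  proof -
    have "card p = 2" if "p \<in> P" for p
      using blocks that unfolding skolem_block_def by force
    then have "sum card P = 2 * card P" by simp
    moreover have "sum card P = 2 * n"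
      using product_partition[OF P] finite_subset[OF _ finite_atLeastAtMost] partition_onD1[OF P]
      by (metis Sup_upper card_atLeastAtMost diff_Suc_1 One_nat_def)
    ultimately show ?thesis by simp
  qed
  then show ?thesis
    unfolding perfect_multi_skolem_def skolem_seqs_def skolem_block_def[symmetric] by blast
qed

theorem theorem11:
  fixes n :: nat
  assumes "n \<ge> 1"
  shows "card {x. perfect_multi_skolem n x} = odd_double_fact n"
  using card_skolem_seqs[of "{1..2 * n}" n] by (simp add: perfect_multi_skolem_iff)

end
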